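(* Let $p \ge 7$ be a regular prime and let $s \ge 2$ be an integer. Let $(x)_p = x(x-1)(x-2)\cdots(x-p+1)$ denote the falling factorial, and suppose that the polynomial $$f(x) = (x)_p - (p-1)!\,x + p^s$$ is irreducible over $\mathbb{Q}$. Then $f(x)$ is not monogenic.
   Context: A monic irreducible polynomial $f(x) \in \mathbb{Z}[x]$ with a root $\theta$ is called monogenic if $[\mathbb{Z}_K : \mathbb{Z}[\theta]] = 1$, where $K = \mathbb{Q}(\theta)$ and $\mathbb{Z}_K$ is the ring of integers of $K$. The Bernoulli numbers $B_n$ are defined by $\frac{x}{e^x - 1} = \sum_{n=0}^{\infty} B_n \frac{x^n}{n!}$. An odd prime $p$ is regular if $p$ does not divide the numerator of any of the Bernoulli numbers $B_0, \ldots, B_{p-3}$. *)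

theory Defs
  imports "HOL-Computational_Algebra.Computational_Algebra"
begin

definition bernoulli_fps :: "rat fps" where
  "bernoulli_fps = fps_X / (fps_exp 1 - 1)"

definition bernoulli :: "nat \<Rightarrow> rat" where
  "bernoulli n = fact n * fps_nth bernoulli_fps n"

text \<open>The series \<open>exp x - 1\<close> has constant term 0, so the quotient above is not a
  multiplication with an inverse series; the following fact confirms that it is the intended
  power series.\<close>

lemma bernoulli_fps_mult: "bernoulli_fps * (fps_exp 1 - 1) = fps_X"
proof -
  let ?e = "fps_exp 1 - 1 :: rat fps"
  have nz: "fps_nth ?e 1 \<noteq> 0" by simp
  have "?e \<noteq> 0" using nz by (metis fps_zero_nth)
  moreover have "subdegree ?e = 1"
    by (rule subdegreeI) (use nz in auto)
  ultimately have "?e dvd fps_X"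
    by (subst fps_dvd_iff) (auto simp: fps_X_neq_zero)
  then show ?thesis
    unfolding bernoulli_fps_def by (rule dvd_div_mult_self)
qed

text \<open>\<open>B\<^sub>n = 0\<close> for odd \<open>n \<ge> 3\<close>, and \<open>p\<close> divides the numerator 0 of these; as usual, only
  the nonzero Bernoulli numbers are meant (otherwise no prime \<open>p \<ge> 7\<close> would be
  regular). The numerator is that of the fraction in lowest terms.\<close>

definition regular_prime :: "nat \<Rightarrow> bool" where
  "regular_prime p \<longleftrightarrow> prime p \<and> odd p \<and>
     (\<forall>n \<le> p - 3. bernoulli n \<noteq> 0 \<longrightarrow> \<not> int p dvd fst (quotient_of (bernoulli n)))"

definition Q_adjoin :: "complex \<Rightarrow> complex set" where
  "Q_adjoin \<theta> = {poly (map_poly of_rat a) \<theta> / poly (map_poly of_rat b) \<theta> | a b :: rat poly.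
     poly (map_poly of_rat b) \<theta> \<noteq> 0}"

definition Z_adjoin :: "complex \<Rightarrow> complex set" where
  "Z_adjoin \<theta> = {poly (map_poly of_int a) \<theta> | a :: int poly. True}"

definition ring_of_integers :: "complex set \<Rightarrow> complex set" where
  "ring_of_integers K = {x \<in> K. algebraic_int x}"

text \<open>The index \<open>[G : H]\<close> of additive groups \<open>H \<subseteq> G\<close>; by the convention
  for \<open>card\<close> it is 0 if there are infinitely many cosets.\<close>

definition add_index :: "'a :: ab_group_add set \<Rightarrow> 'a set \<Rightarrow> nat" where
  "add_index G H = card (G // {(x, y). x \<in> G \<and> y \<in> G \<and> x - y \<in> H})"

text \<open>The number field is realised inside the complex numbers. The roots of an irreducible
  polynomial are conjugate, so the index does not depend on the chosen root.\<close>

definition monogenic :: "int poly \<Rightarrow> bool" where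
  "monogenic f \<longleftrightarrow> lead_coeff f = 1 \<and> irreducible (map_poly rat_of_int f) \<and>
     (\<exists>\<theta> :: complex. poly (map_poly of_int f) \<theta> = 0 \<and>
        add_index (ring_of_integers (Q_adjoin \<theta>)) (Z_adjoin \<theta>) = 1)"

definition falling_factorial_poly :: "nat \<Rightarrow> int poly" where
  "falling_factorial_poly n = (\<Prod>i<n. [:- int i, 1:])"

end

theory Submission
  imports Defs "HOL-Computational_Algebra.Field_as_Ring"
begin

text \<open>
  In \<open>f\<close> the linear term of the falling factorial is \<open>(-1)\<^sup>p\<^sup>-\<^sup>1 (p - 1)! x\<close>, which for odd \<open>p\<close>
  is cancelled by \<open>- (p - 1)! x\<close>. So \<open>f\<close> has linear coefficient \<open>0\<close> and constant
  coefficient \<open>p\<^sup>s\<close>, which is divisible by \<open>p\<^sup>2\<close>; this is the obstruction to monogenicity.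

  Let \<open>f = m\<^sup>2 d + x h\<close> be any monic irreducible integer polynomial of degree at least \<open>2\<close>
  whose linear coefficient is divisible by \<open>m > 1\<close>, let \<open>\<theta>\<close> be a root, and put
  \<open>\<alpha> = h(\<theta>) / m\<close>, so that \<open>\<theta> \<alpha> = - m d\<close>. Multiplying \<open>f(\<theta>) = 0\<close> by
  \<open>\<alpha>\<^sup>n\<close>, where \<open>n\<close> is the degree of \<open>f\<close>, gives a polynomial equation for \<open>\<alpha>\<close>
  in which the coefficient \<open>a\<^sub>j\<close> of \<open>f\<close> reappears as \<open>a\<^sub>j (- m d)\<^sup>j\<close>. All of these
  numbers are divisible by the leading one, \<open>m\<^sup>2 d\<close>: for \<open>j = 1\<close> because \<open>m\<close>
  divides \<open>a\<^sub>1\<close>, and for \<open>j \<ge> 2\<close> because of the power. Dividing by \<open>m\<^sup>2 d\<close>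
  shows that \<open>\<alpha>\<close> is an algebraic integer (\<open>algebraic_int_cofactor\<close>).

  On the other hand the powers of \<open>\<theta>\<close> below \<open>n\<close> are linearly independent, so the only
  way to write \<open>\<alpha>\<close> as a combination of them with rational coefficients is \<open>h / m\<close>, whose
  leading coefficient \<open>1 / m\<close> is not an integer. Hence \<open>\<alpha>\<close> is not in \<open>\<int>[\<theta>]\<close>
  (\<open>cofactor_quotient_not_in_Z_adjoin\<close>), and the index is not \<open>1\<close>.
\<close>

lemma poly_of_rat_of_int:
  "map_poly of_rat (map_poly rat_of_int a) = (map_poly of_int a :: 'a :: field_char_0 poly)"
  by (subst map_poly_map_poly) (simp_all add: o_def)

lemma poly_of_int_add:
  "poly (map_poly of_int (a + b)) x = poly (map_poly of_int a) x + poly (map_poly of_int b) (x :: 'a :: comm_ring_1)"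
  by (induction a b rule: poly_induct2) (simp_all add: map_poly_pCons algebra_simps)

lemma poly_of_int_smult:
  "poly (map_poly of_int (smult c a)) x = of_int c * poly (map_poly of_int a) (x :: 'a :: comm_ring_1)"
  by (induction a) (simp_all add: map_poly_pCons algebra_simps)

lemma poly_of_int_mult:
  "poly (map_poly of_int (a * b)) x = poly (map_poly of_int a) x * poly (map_poly of_int b) (x :: 'a :: comm_ring_1)"
  by (induction a)
     (simp_all add: map_poly_pCons poly_of_int_add poly_of_int_smult algebra_simps)

lemma poly_of_rat_add:
  "poly (map_poly of_rat (a + b)) x = poly (map_poly of_rat a) x + poly (map_poly of_rat b) (x :: 'a :: field_char_0)"
  by (induction a b rule: poly_induct2) (simp_all add: map_poly_pCons of_rat_add algebra_simps)

lemma poly_of_rat_smult: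
  "poly (map_poly of_rat (smult c a)) x = of_rat c * poly (map_poly of_rat a) (x :: 'a :: field_char_0)"
  by (induction a) (simp_all add: map_poly_pCons of_rat_mult algebra_simps)

lemma poly_of_rat_mult:
  "poly (map_poly of_rat (a * b)) x = poly (map_poly of_rat a) x * poly (map_poly of_rat b) (x :: 'a :: field_char_0)"
  by (induction a)
     (simp_all add: map_poly_pCons poly_of_rat_add poly_of_rat_smult algebra_simps)

text \<open>An irreducible polynomial is, up to a unit, the minimal polynomial of its root: a nonzero
  \<open>r\<close> of smaller degree would be coprime to \<open>f\<close>, and a Bezout identity
  \<open>u f + v r = 1\<close> fails at a common root.\<close>

lemma irreducible_min_degree:
  fixes f r :: "rat poly" and \<theta> :: "'a :: field_char_0"
  assumes "irreducible f" "poly (map_poly of_rat f) \<theta> = 0" "poly (map_poly of_rat r) \<theta> = 0"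
    and "degree r < degree f"
  shows "r = 0"
proof (rule ccontr)
  assume "r \<noteq> 0"
  then have "\<not> f dvd r"
    using assms(4) dvd_imp_degree_le[of f r] by auto
  then have "coprime f r"
    using prime_elem_imp_coprime[OF irreducible_imp_prime_elem_gcd[OF assms(1)]] by simp
  then obtain u v where "u * f + v * r = 1"
    using bezout_coefficients_fst_snd[of f r] by auto
  then have "poly (map_poly of_rat (u * f + v * r)) \<theta> = 1" by simp
  then show False
    using assms(2,3) by (simp add: poly_of_rat_add poly_of_rat_mult)
qed

text \<open>Pseudo-division scales the dividend by a power of the leading coefficient of the divisor, so
  for a monic divisor it is division with remainder over \<open>\<int>\<close>.\<close>

lemma monic_division:
  fixes f g :: "int poly"
  assumes "lead_coeff f = 1" "degree f > 0"
  obtains q r where "g = f * q + r" "degree r < degree f"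
proof -
  obtain q r where qr: "pseudo_divmod g f = (q, r)" by (cases "pseudo_divmod g f")
  have f0: "f \<noteq> 0" using assms by auto
  from pseudo_divmod[OF f0 qr] have "g = f * q + r" "r = 0 \<or> degree r < degree f"
    using assms by auto
  then show ?thesis using that[of q r] assms(2) by auto
qed

text \<open>The monic polynomial \<open>g\<close> that annihilates \<open>\<alpha> = - m d / \<theta>\<close> is the
  reciprocal polynomial of \<open>f(- m d x)\<close> divided by \<open>m\<^sup>2 d\<close>, which is both the leading
  coefficient of that reciprocal and a divisor of all its other coefficients.\<close>

lemma algebraic_int_cofactor:
  fixes f :: "int poly" and \<theta> \<alpha> :: complex and m d :: int
  assumes root: "poly (map_poly of_int f) \<theta> = 0"
    and c0: "coeff f 0 = m\<^sup>2 * d" and nz: "m \<noteq> 0" "d \<noteq> 0"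
    and c1: "m dvd coeff f 1" and prod: "\<theta> * \<alpha> = of_int (- m * d)"
  shows "algebraic_int \<alpha>"
proof -
  define n where "n = degree f"
  have "\<exists>b. coeff f j * (- m * d) ^ j = m\<^sup>2 * d * b \<and> (j = 0 \<longrightarrow> b = 1)" for j
  proof -
    consider "j = 0" | "j = 1" | k where "j = Suc (Suc k)"
      by (metis One_nat_def not0_implies_Suc)
    then show ?thesis
    proof cases
      case 1
      then show ?thesis using c0 by auto
    next
      case 2
      obtain e where "coeff f 1 = m * e" using c1 by auto
      then show ?thesis using 2
        by (intro exI[of _ "- e"]) (simp add: power2_eq_square)
    next
      case 3
      then show ?thesis
        by (intro exI[of _ "coeff f j * d * (- m * d) ^ k"]) (simp add: power2_eq_square)
    qed
  qed
  then obtain b where b: "\<And>j. coeff f j * (- m * d) ^ j = m\<^sup>2 * d * b j" and b0: "b 0 = 1"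
    by metis
  define g where "g = (\<Sum>j\<le>n. monom (b j) (n - j))"
  have "coeff g n = (\<Sum>j\<le>n. if j = 0 then b j else 0)"
    unfolding g_def coeff_sum by (intro sum.cong) (auto simp: coeff_monom)
  then have "coeff g n = 1" using b0 by simp
  moreover have "degree g \<le> n"
    unfolding g_def by (intro degree_sum_le) (auto intro: order.trans[OF degree_monom_le])
  ultimately have monic: "lead_coeff g = 1"
    by (metis coeff_eq_0 le_neq_implies_less zero_neq_one)
  have "poly (map_poly of_int g) \<alpha> = (\<Sum>j\<le>n. of_int (b j) * \<alpha> ^ (n - j))"
  proof -
    have "poly (map_poly of_int (\<Sum>j\<in>A. monom (b j) (n - j))) \<alpha>
            = (\<Sum>j\<in>A. of_int (b j) * \<alpha> ^ (n - j))" if "finite A" for A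
      using that by induction (simp_all add: poly_of_int_add map_poly_monom poly_monom)
    then show ?thesis by (simp add: g_def)
  qed
  then have "of_int (m\<^sup>2 * d) * poly (map_poly of_int g) \<alpha>
      = (\<Sum>j\<le>n. of_int (m\<^sup>2 * d * b j) * \<alpha> ^ (n - j))"
    by (simp add: sum_distrib_left mult.assoc)
  also have "\<dots> = (\<Sum>j\<le>n. of_int (coeff f j) * (\<theta> * \<alpha>) ^ j * \<alpha> ^ (n - j))"
    unfolding b[symmetric] prod by simp
  also have "\<dots> = (\<Sum>j\<le>n. \<alpha> ^ n * (of_int (coeff f j) * \<theta> ^ j))"
    by (intro sum.cong) (auto simp: power_mult_distrib simp flip: power_add)
  also have "\<dots> = \<alpha> ^ n * poly (map_poly of_int f) \<theta>"
    by (simp add: poly_altdef n_def sum_distrib_left degree_map_poly coeff_map_poly)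
  finally have "poly (map_poly of_int g) \<alpha> = 0"
    using root nz by simp
  then show ?thesis
    using monic by (auto simp: algebraic_int_altdef_ipoly)
qed

text \<open>If \<open>h(\<theta>) / m\<close> were \<open>g(\<theta>)\<close> with \<open>g\<close> integral, then reducing
  \<open>g\<close> modulo \<open>f\<close> to a remainder \<open>r\<close> makes \<open>h - m r\<close> vanish at
  \<open>\<theta>\<close> in degree less than that of \<open>f\<close>. So \<open>h = m r\<close>, and \<open>m\<close> would
  divide the leading coefficient \<open>1\<close> of \<open>h\<close>.\<close>

lemma cofactor_quotient_not_in_Z_adjoin:
  fixes f h :: "int poly" and m :: int
  assumes irr: "irreducible (map_poly rat_of_int f)" and monic: "lead_coeff f = 1"
    and root: "poly (map_poly of_int f) \<theta> = 0"
    and h: "lead_coeff h = 1" "degree h < degree f" and m: "m > 1"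
  shows "poly (map_poly of_int h) \<theta> / of_int m \<notin> Z_adjoin \<theta>"
proof
  assume "poly (map_poly of_int h) \<theta> / of_int m \<in> Z_adjoin \<theta>"
  then obtain g where g: "poly (map_poly of_int h) \<theta> / of_int m = poly (map_poly of_int g) \<theta>"
    by (auto simp: Z_adjoin_def)
  obtain q r where qr: "g = f * q + r" "degree r < degree f"
    using monic_division[OF monic] h by (metis gr_zeroI not_less_zero)
  define e where "e = h + smult (- m) r"
  have "poly (map_poly of_int e) \<theta>
      = poly (map_poly of_int h) \<theta> + of_int (- m) * poly (map_poly of_int r) \<theta>"
    by (simp only: e_def poly_of_int_add poly_of_int_smult)
  also have "\<dots> = 0"
    using g qr(1) root m by (simp add: poly_of_int_add poly_of_int_mult field_simps)
  finally have "poly (map_poly of_int e) \<theta> = 0" .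
  moreover have "degree e < degree f"
    unfolding e_def using h(2) qr(2)
    by (intro degree_add_less le_less_trans[OF degree_smult_le]) simp_all
  ultimately have "map_poly rat_of_int e = 0"
    using root by (intro irreducible_min_degree[OF irr, of \<theta>])
      (simp_all add: poly_of_rat_of_int degree_map_poly)
  then have "e = 0"
    by (simp add: map_poly_eq_0_iff)
  then have "lead_coeff h = m * coeff r (degree h)"
    by (simp add: e_def)
  then have "1 = m * coeff r (degree h)" unfolding h(1) .
  then have "m dvd 1" by (rule dvdI)
  then show False using m by simp
qed

lemma add_index_one_imp_subset:
  assumes "add_index G H = 1" "0 \<in> G" "0 \<in> H"
  shows "G \<subseteq> H"
proof
  fix x assume x: "x \<in> G"
  let ?R = "{(x, y). x \<in> G \<and> y \<in> G \<and> x - y \<in> H}"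
  obtain C where C: "G // ?R = {C}"
    using assms(1) unfolding add_index_def by (rule card_1_singletonE)
  have "?R `` {0} = C" "?R `` {x} = C"
    using quotientI[OF assms(2), of ?R] quotientI[OF x, of ?R] unfolding C by simp_all
  moreover have "0 \<in> ?R `` {0}" using assms by simp
  ultimately have "0 \<in> ?R `` {x}" by simp
  then show "x \<in> H" by simp
qed

text \<open>When \<open>m\<close> is prime and \<open>f \<equiv> x\<^sup>n\<close> modulo \<open>m\<close>, this is the
  negative half of Dedekind's index criterion: \<open>(f - x\<^sup>n) / m\<close> is then divisible by
  \<open>x\<close> modulo \<open>m\<close>. The explicit integral element outside \<open>\<int>[\<theta>]\<close> gives the
  result for composite \<open>m\<close> and other reductions as well.\<close>

theorem not_monogenic_if_square_dvd_coeff_0: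
  fixes f :: "int poly" and m :: int
  assumes m: "m > 1" "m\<^sup>2 dvd coeff f 0" "m dvd coeff f 1" and deg: "degree f \<ge> 2"
  shows "\<not> monogenic f"
proof
  assume "monogenic f"
  then obtain \<theta> :: complex where monic: "lead_coeff f = 1"
    and irr: "irreducible (map_poly rat_of_int f)"
    and root: "poly (map_poly of_int f) \<theta> = 0"
    and idx: "add_index (ring_of_integers (Q_adjoin \<theta>)) (Z_adjoin \<theta>) = 1"
    by (auto simp: monogenic_def)
  obtain c h where f: "f = pCons c h" by (cases f)
  have h0: "h \<noteq> 0" using deg f by auto
  have h: "lead_coeff h = 1" "degree h < degree f"
    using monic h0 by (auto simp: f)
  obtain d where d: "c = m\<^sup>2 * d" using m f by auto
  \<comment> \<open>\<open>x\<close> and \<open>h\<close> are nonzero and of smaller degree than \<open>f\<close>, so neither vanishes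
    at the root; hence the constant coefficient, and with it \<open>d\<close>, is nonzero and may be divided out.\<close>
  have "\<theta> \<noteq> 0"
  proof
    assume "\<theta> = 0"
    then have "[:0, 1:] = (0 :: rat poly)"
      using root deg by (intro irreducible_min_degree[OF irr, of \<theta>])
        (simp_all add: poly_of_rat_of_int map_poly_pCons degree_map_poly)
    then show False by simp
  qed
  have "poly (map_poly of_int h) \<theta> \<noteq> 0"
  proof
    assume "poly (map_poly of_int h) \<theta> = 0"
    then have "map_poly rat_of_int h = 0"
      using root h by (intro irreducible_min_degree[OF irr, of \<theta>])
        (simp_all add: poly_of_rat_of_int degree_map_poly)
    then show False using h0 by (simp add: map_poly_eq_0_iff)
  qed
  define \<alpha> where "\<alpha> = poly (map_poly of_int h) \<theta> / of_int m"
  have eq: "\<theta> * poly (map_poly of_int h) \<theta> = - of_int (m\<^sup>2 * d)"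
    using root by (simp add: f d map_poly_pCons add_eq_0_iff)
  then have "d \<noteq> 0"
    using \<open>\<theta> \<noteq> 0\<close> \<open>poly (map_poly of_int h) \<theta> \<noteq> 0\<close> by auto
  have "\<theta> * \<alpha> = of_int (- m * d)"
    using eq m by (simp add: \<alpha>_def field_simps power2_eq_square)
  then have "algebraic_int \<alpha>"
    using algebraic_int_cofactor[OF root _ _ \<open>d \<noteq> 0\<close> m(3)] m(1) by (simp add: f d)
  moreover have "\<alpha> \<in> Q_adjoin \<theta>"
    unfolding Q_adjoin_def \<alpha>_def using m(1)
    by (intro CollectI exI[of _ "map_poly rat_of_int h"] exI[of _ "[:rat_of_int m:]"])
      (simp add: poly_of_rat_of_int map_poly_pCons)
  ultimately have "\<alpha> \<in> ring_of_integers (Q_adjoin \<theta>)"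
    by (simp add: ring_of_integers_def)
  moreover have "0 \<in> Q_adjoin \<theta>"
  proof -
    have "0 = poly (map_poly of_rat 0) \<theta> / poly (map_poly of_rat 1) \<theta> \<and>
        poly (map_poly of_rat 1) \<theta> \<noteq> 0"
      by simp
    then show ?thesis unfolding Q_adjoin_def by blast
  qed
  then have "0 \<in> ring_of_integers (Q_adjoin \<theta>)"
    by (simp add: ring_of_integers_def)
  moreover have "0 \<in> Z_adjoin \<theta>"
    unfolding Z_adjoin_def by (auto intro!: exI[of _ "0 :: int poly"])
  ultimately have "\<alpha> \<in> Z_adjoin \<theta>"
    using add_index_one_imp_subset[OF idx] by blast
  then show False
    using cofactor_quotient_not_in_Z_adjoin[OF irr monic root h m(1)] unfolding \<alpha>_def by blast
qed

lemma degree_falling_factorial_poly: "degree (falling_factorial_poly n) = n"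
  unfolding falling_factorial_poly_def by (subst degree_prod_eq_sum_degree) simp_all

lemma falling_factorial_poly_Suc:
  "falling_factorial_poly (Suc n) = pCons 0 (\<Prod>i<n. [:- int (Suc i), 1:])"
  unfolding falling_factorial_poly_def by (subst prod.lessThan_Suc_shift) simp

lemma coeff_1_falling_factorial_poly:
  "coeff (falling_factorial_poly (Suc n)) 1 = (- 1) ^ n * fact n"
proof -
  have "coeff (falling_factorial_poly (Suc n)) 1 = (\<Prod>i<n. - int (Suc i))"
    by (simp add: falling_factorial_poly_Suc flip: poly_0_coeff_0 add: poly_prod)
  also have "\<dots> = (- 1) ^ n * fact n"
    by (induction n) (simp_all add: algebra_simps)
  finally show ?thesis .
qed

theorem theorem4p4:
  fixes p s :: nat and f :: "int poly"
  assumes "regular_prime p" and "p \<ge> 7" and "s \<ge> 2"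
    and "f = falling_factorial_poly p - smult (fact (p - 1)) [:0, 1:] + [:int p ^ s:]"
    and "irreducible (map_poly rat_of_int f)"
  shows "\<not> monogenic f"
proof (rule not_monogenic_if_square_dvd_coeff_0[of "int p"])
  obtain n where n: "p = Suc n" using assms(2) by (cases p) auto
  have "even n" using assms(1) by (simp add: regular_prime_def n)
  then have "coeff f 1 = 0"
    using coeff_1_falling_factorial_poly[of n] by (simp add: assms(4) n)
  then show "int p dvd coeff f 1" by simp
  have "coeff f 0 = int p ^ s"
    by (simp add: assms(4) n falling_factorial_poly_Suc)
  then show "(int p)\<^sup>2 dvd coeff f 0"
    using assms(3) by (simp add: le_imp_power_dvd)
  obtain k where k: "p = Suc (Suc k)"
    using assms(2) n by (cases n) auto
  have "coeff f p = coeff (falling_factorial_poly p) p"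
    by (simp add: assms(4) k)
  also have "\<dots> \<noteq> 0"
  proof -
    have "falling_factorial_poly p \<noteq> 0"
      using degree_falling_factorial_poly[of p] k by auto
    then show ?thesis
      using degree_falling_factorial_poly[of p] leading_coeff_0_iff[of "falling_factorial_poly p"]
      by simp
  qed
  finally have "degree f \<ge> p" by (rule le_degree)
  then show "degree f \<ge> 2" using assms(2) by simp
  show "int p > 1" using assms(2) by simp
qed

end
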